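(* Let $y,\rho,q\in\mathbb{R}$ be fixed and let $\mu=\mu(dx|\rho,y)$ be a probability measure on $\mathbb{R}$ (with finite moments of all orders) such that $$\int H_n(x|q)\,\mu(dx)=\rho^nH_n(y|q),\qquad n=1,2,\dots.$$ Then the orthogonal polynomials of $\mu$ are the Al-Salam--Chihara polynomials $\{p_n(x|q,a,b)\}_{n\ge0}$ with $a=\rho y$ and $b=\rho^2$; that is, $\int p_k(x|q,\rho y,\rho^2)\,p_n(x|q,\rho y,\rho^2)\,\mu(dx)=0$ for all $0\le k<n$.
   Context: Notation: $[n]_q=1+q+\dots+q^{n-1}$, $[0]_q=0$. The convention $q^0=1$ is used also for $q=0$. The (renormalized) Al-Salam--Chihara polynomials $p_n(x)=p_n(x|q,a,b)$ are the monic polynomials defined by $p_{-1}(x)=0$, $p_0(x)=1$ and $$p_{n+1}(x)=(x-aq^n)p_n(x)-(1-bq^{n-1})[n]_q\,p_{n-1}(x)\quad(n\ge 0),$$ where the last term vanishes for $n=0$. The (renormalized) continuous $q$-Hermite polynomials are $H_n(x|q)=p_n(x|q,0,0)$, i.e. $H_{-1}=0$, $H_0=1$, $H_{n+1}(x)=xH_n(x)-[n]_qH_{n-1}(x)$ for $n\ge0$. *)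

theory Defs
  imports "HOL-Probability.Probability" "HOL-Computational_Algebra.Polynomial"
begin

definition q_bracket :: "real \<Rightarrow> nat \<Rightarrow> real" where
  "q_bracket q n = (\<Sum>k<n. q ^ k)"

text \<open>
  The three-term recurrence
  \<open>p (n+1) = (x - a q^n) p n - (1 - b q^(n-1)) [n] p (n-1)\<close>, with the cases \<open>n = 0\<close>
  (where the last term vanishes) and \<open>n \<ge> 1\<close> (shifted by one, so that all exponents
  are natural numbers) written separately.  The polynomial \<open>[:- c, 1:]\<close> is \<open>x - c\<close>.
\<close>

fun al_salam_chihara :: "real \<Rightarrow> real \<Rightarrow> real \<Rightarrow> nat \<Rightarrow> real poly" where
  "al_salam_chihara q a b 0 = 1"
| "al_salam_chihara q a b (Suc 0) = [:- a, 1:]"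
| "al_salam_chihara q a b (Suc (Suc n)) =
     [:- (a * q ^ Suc n), 1:] * al_salam_chihara q a b (Suc n)
     - smult ((1 - b * q ^ n) * q_bracket q (Suc n)) (al_salam_chihara q a b n)"

definition q_hermite :: "real \<Rightarrow> nat \<Rightarrow> real poly" where
  "q_hermite q n = al_salam_chihara q 0 0 n"

lemma al_salam_chihara_recurrence:
  "poly (al_salam_chihara q a b (n + 1)) x =
     (x - a * q ^ n) * poly (al_salam_chihara q a b n) x
     - (if n = 0 then 0
        else (1 - b * q ^ (n - 1)) * q_bracket q n * poly (al_salam_chihara q a b (n - 1)) x)"
  by (cases n) (auto simp: algebra_simps)

lemma q_hermite_recurrence:
  "poly (q_hermite q (n + 1)) x =
     x * poly (q_hermite q n) x
     - (if n = 0 then 0 else q_bracket q n * poly (q_hermite q (n - 1)) x)"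
  unfolding q_hermite_def al_salam_chihara_recurrence by simp

lemma al_salam_chihara_monic:
  "degree (al_salam_chihara q a b n) = n \<and> lead_coeff (al_salam_chihara q a b n) = 1"
proof (induction q a b n rule: al_salam_chihara.induct)
  case (3 q a b n)
  let ?p = "[:- (a * q ^ Suc n), 1:] * al_salam_chihara q a b (Suc n)"
  let ?r = "smult (- ((1 - b * q ^ n) * q_bracket q (Suc n))) (al_salam_chihara q a b n)"
  have nz: "al_salam_chihara q a b (Suc n) \<noteq> 0"
    using 3 by auto
  have dp: "degree ?p = Suc (Suc n)"
    using nz 3 by (subst degree_mult_eq) auto
  have lp: "lead_coeff ?p = 1"
    using 3 by (subst lead_coeff_mult) auto
  have "degree ?r < degree ?p"
    unfolding dp using 3 degree_smult_le[of _ "al_salam_chihara q a b n"]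
    by (metis le_imp_less_Suc less_SucI)
  moreover have "al_salam_chihara q a b (Suc (Suc n)) = ?r + ?p"
    by simp
  ultimately show ?case
    using dp lp by (metis degree_add_eq_right lead_coeff_add_le)
qed auto

end

theory Submission
  imports Defs
begin

text \<open>
  Expand \<open>p n = (\<Sum>k\<le>n. c n k * H k)\<close>. The coefficients satisfy \<open>[k] c n k = [n] c (n-1) (k-1)\<close>:
  the operator that lowers \<open>H k\<close> to \<open>[k] H (k-1)\<close> also lowers \<open>p n\<close> to \<open>[n] p (n-1)\<close>. Hence for
  every sequence with \<open>h (k+1) = x h k - r [k] h (k-1)\<close> the sums \<open>s n = (\<Sum>k\<le>n. c n k * h k)\<close>
  satisfy \<open>s (n+1) = (x - a q^n) s n - (r - b q^(n-1)) [n] s (n-1)\<close>.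
  The values \<open>h k = H k x\<close> (with \<open>r = 1\<close>) show that \<open>c\<close> really gives the expansion of \<open>p n\<close>; the
  moments \<open>h k = \<rho>^k H k y\<close> (with \<open>x = \<rho> y = a\<close> and \<open>r = \<rho>\<^sup>2 = b\<close>) show that \<open>s n\<close>, the integral of
  \<open>p n\<close>, vanishes for \<open>n \<ge> 1\<close>, because \<open>s 1 = 0\<close> and the coefficient of \<open>s 0\<close> in \<open>s 2\<close> is \<open>0\<close>.
  A three-term recurrence then upgrades the vanishing integrals to orthogonality.
\<close>

lemma q_bracket_0 [simp]: "q_bracket q 0 = 0"
  by (simp add: q_bracket_def)

lemma q_bracket_Suc: "q_bracket q (Suc n) = 1 + q * q_bracket q n"
  by (simp add: q_bracket_def sum.lessThan_Suc_shift sum_distrib_left del: sum.lessThan_Suc)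

text \<open>The coefficient of \<open>z^k\<close> in \<open>hermite_coords q a b n\<close> is the \<open>c n k\<close> above.\<close>

fun hermite_coords :: "real \<Rightarrow> real \<Rightarrow> real \<Rightarrow> nat \<Rightarrow> real poly" where
  "hermite_coords q a b 0 = 1"
| "hermite_coords q a b (Suc 0) = [:- a, 1:]"
| "hermite_coords q a b (Suc (Suc n)) =
     [:- (a * q ^ Suc n), 1:] * hermite_coords q a b (Suc n)
     + smult (b * q ^ n * q_bracket q (Suc n)) (hermite_coords q a b n)"

lemma coeff_hermite_coords_eq_0: "n < k \<Longrightarrow> coeff (hermite_coords q a b n) k = 0"
proof (induction q a b n arbitrary: k rule: hermite_coords.induct)
  case (2 q a b)
  then show ?case by (auto simp: coeff_pCons split: nat.splits)
next
  case (3 q a b n)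
  then show ?case by (auto simp: coeff_pCons split: nat.splits)
qed auto

text \<open>Strong induction along the recurrence of \<open>hermite_coords\<close>. After the split
  \<open>[k+1] = 1 + q [k]\<close> the lowered terms add up to \<open>q [m+1]\<close> times that
  recurrence one index earlier, and \<open>1 + q [m+1] = [m+2]\<close>.\<close>

lemma q_bracket_coeff_hermite_coords:
  "q_bracket q (Suc k) * coeff (hermite_coords q a b (Suc n)) (Suc k)
     = q_bracket q (Suc n) * coeff (hermite_coords q a b n) k"
proof (induction n arbitrary: k rule: less_induct)
  case (less n)
  let ?c = "\<lambda>n. coeff (hermite_coords q a b n)"
  consider "n = 0" | m where "n = Suc m" by (cases n) auto
  then show ?case
  proof cases
    case 1
    then show ?thesis by (cases k) (auto simp: coeff_pCons q_bracket_Suc split: nat.splits)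
  next
    case (2 m)
    have low: "q_bracket q (Suc k) * ?c (Suc m) (Suc k) = q_bracket q (Suc m) * ?c m k"
      using less.IH[of m k] 2 by simp
    \<comment> \<open>For \<open>m = 0\<close> both sides are \<open>0\<close>, so the truncated
      \<open>m - 1\<close> is harmless.\<close>
    have lower: "q_bracket q (Suc k) * ?c m (Suc k) = q_bracket q m * ?c (m - 1) k"
      using less.IH[of "m - 1" k] 2
      by (cases m) auto
    have shifted: "q_bracket q k * ?c (Suc m) k
        = q_bracket q (Suc m) * (if k = 0 then 0 else ?c m (k - 1))"
      using less.IH[of m "k - 1"] 2 by (cases k) auto
    have expand: "?c (Suc m) k = (if k = 0 then 0 else ?c m (k - 1)) - a * q ^ m * ?c m k
        + b * q ^ (m - 1) * q_bracket q m * ?c (m - 1) k"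
      by (cases m; cases k) (auto simp: coeff_pCons split: nat.splits)
    \<comment> \<open>At \<open>m = 0\<close> the powers of \<open>q\<close> do not match; there the
      identity holds because \<open>[0] = 0\<close>.\<close>
    have pow: "q * (q ^ (m - 1) * q_bracket q m) = q ^ m * q_bracket q m"
      by (cases m) auto
    have "q_bracket q (Suc k) * ?c (Suc (Suc m)) (Suc k)
        = q_bracket q (Suc k) * ?c (Suc m) k
          - a * q ^ Suc m * (q_bracket q (Suc k) * ?c (Suc m) (Suc k))
          + b * q ^ m * q_bracket q (Suc m) * (q_bracket q (Suc k) * ?c m (Suc k))"
      by (simp add: algebra_simps)
    also have "\<dots> = ?c (Suc m) k + q * (q_bracket q k * ?c (Suc m) k)
          - a * q ^ Suc m * (q_bracket q (Suc m) * ?c m k)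
          + b * q ^ m * q_bracket q (Suc m) * (q_bracket q m * ?c (m - 1) k)"
      unfolding low lower by (simp add: q_bracket_Suc[of q k] algebra_simps)
    also have "\<dots> = ?c (Suc m) k + q * q_bracket q (Suc m) * (if k = 0 then 0 else ?c m (k - 1))
          - a * q ^ Suc m * (q_bracket q (Suc m) * ?c m k)
          + b * q_bracket q (Suc m) * (q * (q ^ (m - 1) * q_bracket q m)) * ?c (m - 1) k"
      unfolding shifted pow by simp
    also have "\<dots> = ?c (Suc m) k + q * q_bracket q (Suc m) * ?c (Suc m) k"
      unfolding expand by (simp add: algebra_simps)
    also have "\<dots> = q_bracket q (Suc (Suc m)) * ?c (Suc m) k"
      by (simp add: q_bracket_Suc[of q "Suc m"] algebra_simps)
    finally show ?thesis using 2 by simp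
  qed
qed

text \<open>The value at \<open>al_salam_chihara q a b n\<close> of the linear functional that sends
  each \<open>q_hermite q k\<close> to \<open>h k\<close>.\<close>

definition hermite_comb :: "real \<Rightarrow> real \<Rightarrow> real \<Rightarrow> nat \<Rightarrow> (nat \<Rightarrow> real) \<Rightarrow> real" where
  "hermite_comb q a b n h = (\<Sum>k\<le>n. coeff (hermite_coords q a b n) k * h k)"

lemma hermite_comb_atMost:
  assumes "n \<le> N"
  shows "hermite_comb q a b n h = (\<Sum>k\<le>N. coeff (hermite_coords q a b n) k * h k)"
  unfolding hermite_comb_def using assms
  by (intro sum.mono_neutral_left) (auto simp: coeff_hermite_coords_eq_0)

text \<open>The factor \<open>[0] = 0\<close> removes the term with truncated \<open>k - 1\<close>;
  after reindexing, the lowering identity applies to each coefficient.\<close>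

lemma hermite_comb_lower:
  "hermite_comb q a b (Suc n) (\<lambda>k. q_bracket q k * h (k - 1))
     = q_bracket q (Suc n) * hermite_comb q a b n h"
proof -
  have "hermite_comb q a b (Suc n) (\<lambda>k. q_bracket q k * h (k - 1))
      = (\<Sum>k\<le>n. (q_bracket q (Suc k) * coeff (hermite_coords q a b (Suc n)) (Suc k)) * h k)"
    unfolding hermite_comb_def by (subst sum.atMost_Suc_shift) (simp add: mult_ac)
  then show ?thesis
    unfolding q_bracket_coeff_hermite_coords by (simp add: hermite_comb_def sum_distrib_left mult_ac)
qed

text \<open>Multiplication by the variable in \<open>hermite_coords\<close> becomes a shift of
  \<open>h\<close>.\<close>

lemma hermite_comb_Suc_Suc:
  "hermite_comb q a b (Suc (Suc n)) h
     = hermite_comb q a b (Suc n) (\<lambda>k. h (Suc k)) - a * q ^ Suc n * hermite_comb q a b (Suc n) h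
       + b * q ^ n * q_bracket q (Suc n) * hermite_comb q a b n h"
proof -
  let ?N = "Suc (Suc n)" and ?c = "\<lambda>n. coeff (hermite_coords q a b n)"
  have "hermite_comb q a b ?N h
      = (\<Sum>k\<le>?N. coeff (pCons 0 (hermite_coords q a b (Suc n))) k * h k
          - a * q ^ Suc n * (?c (Suc n) k * h k)
          + b * q ^ n * q_bracket q (Suc n) * (?c n k * h k))"
    unfolding hermite_comb_def by (intro sum.cong refl) (simp add: algebra_simps)
  also have "\<dots> = (\<Sum>k\<le>?N. coeff (pCons 0 (hermite_coords q a b (Suc n))) k * h k)
          - a * q ^ Suc n * hermite_comb q a b (Suc n) h
          + b * q ^ n * q_bracket q (Suc n) * hermite_comb q a b n h"
    by (simp only: hermite_comb_atMost[of "Suc n" ?N] hermite_comb_atMost[of n ?N]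
        sum.distrib sum_subtractf sum_distrib_left)
  also have "(\<Sum>k\<le>?N. coeff (pCons 0 (hermite_coords q a b (Suc n))) k * h k)
      = hermite_comb q a b (Suc n) (\<lambda>k. h (Suc k))"
    unfolding hermite_comb_def by (subst sum.atMost_Suc_shift) simp
  finally show ?thesis .
qed

lemma hermite_comb_recurrence:
  assumes "\<And>k. h (Suc k) = x * h k - r * (q_bracket q k * h (k - 1))"
  shows "hermite_comb q a b (Suc (Suc n)) h
     = (x - a * q ^ Suc n) * hermite_comb q a b (Suc n) h
       - (r - b * q ^ n) * q_bracket q (Suc n) * hermite_comb q a b n h"
proof -
  have "hermite_comb q a b (Suc n) (\<lambda>k. h (Suc k))
      = x * hermite_comb q a b (Suc n) h
        - r * hermite_comb q a b (Suc n) (\<lambda>k. q_bracket q k * h (k - 1))"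
    unfolding assms
    by (simp add: hermite_comb_def sum_distrib_left sum_subtractf[symmetric] algebra_simps
        del: sum.atMost_Suc)
  then show ?thesis
    unfolding hermite_comb_Suc_Suc hermite_comb_lower by (simp add: algebra_simps)
qed

lemma hermite_comb_0 [simp]: "hermite_comb q a b 0 h = h 0"
  by (simp add: hermite_comb_def)

lemma hermite_comb_Suc_0 [simp]: "hermite_comb q a b (Suc 0) h = h (Suc 0) - a * h 0"
  by (simp add: hermite_comb_def)

lemma q_hermite_0 [simp]: "q_hermite q 0 = 1"
  by (simp add: q_hermite_def)

lemma poly_q_hermite_Suc:
  "poly (q_hermite q (Suc k)) x
     = x * poly (q_hermite q k) x - q_bracket q k * poly (q_hermite q (k - 1)) x"
  using q_hermite_recurrence[of q k x] by (cases k) auto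

lemma poly_al_salam_chihara_eq_hermite_comb:
  "poly (al_salam_chihara q a b n) x = hermite_comb q a b n (\<lambda>k. poly (q_hermite q k) x)"
proof (induction q a b n rule: al_salam_chihara.induct)
  case (2 q a b)
  show ?case by (simp add: poly_q_hermite_Suc)
next
  case (3 q a b n)
  have "hermite_comb q a b (Suc (Suc n)) (\<lambda>k. poly (q_hermite q k) x)
      = (x - a * q ^ Suc n) * poly (al_salam_chihara q a b (Suc n)) x
        - (1 - b * q ^ n) * q_bracket q (Suc n) * poly (al_salam_chihara q a b n) x"
    unfolding 3 by (rule hermite_comb_recurrence) (simp add: poly_q_hermite_Suc)
  then show ?case by (simp add: algebra_simps)
qed simp

lemma hermite_comb_moments_eq_0:
  fixes y \<rho> q :: real
  shows "hermite_comb q (\<rho> * y) (\<rho>\<^sup>2) (Suc n) (\<lambda>k. \<rho> ^ k * poly (q_hermite q k) y) = 0"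
    (is "?s (Suc n) = 0")
proof (induction n rule: less_induct)
  case (less n)
  \<comment> \<open>Scaling the Hermite recurrence at \<open>y\<close> by
    \<open>\<rho> ^ Suc k\<close> gives \<open>x = \<rho> * y\<close> and
    \<open>r = \<rho>\<^sup>2\<close>.\<close>
  have rec: "?s (Suc (Suc m)) = (\<rho> * y - \<rho> * y * q ^ Suc m) * ?s (Suc m)
      - (\<rho>\<^sup>2 - \<rho>\<^sup>2 * q ^ m) * q_bracket q (Suc m) * ?s m" for m
  proof (rule hermite_comb_recurrence)
    fix k
    show "\<rho> ^ Suc k * poly (q_hermite q (Suc k)) y
      = \<rho> * y * (\<rho> ^ k * poly (q_hermite q k) y)
        - \<rho>\<^sup>2 * (q_bracket q k * (\<rho> ^ (k - 1) * poly (q_hermite q (k - 1)) y))"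
      by (cases k) (simp_all add: poly_q_hermite_Suc power2_eq_square algebra_simps)
  qed
  show ?case
  proof (cases n)
    case 0
    then show ?thesis by (simp add: poly_q_hermite_Suc)
  next
    case (Suc m)
    have "?s (Suc m) = 0" using less Suc by simp
    \<comment> \<open>For \<open>m = 0\<close> the value \<open>?s 0\<close> is \<open>1\<close>,
      but its coefficient in \<open>rec\<close> is zero since \<open>q ^ 0 = 1\<close>.\<close>
    moreover have "m = 0 \<or> ?s m = 0" using less.IH[of "m - 1"] Suc by (cases m) auto
    ultimately show ?thesis unfolding Suc rec by auto
  qed
qed

text \<open>A factor \<open>x\<close> moves from \<open>f\<close> onto \<open>p n\<close>; the
  recurrence rewrites \<open>x * p n\<close> by neighbours whose indices still exceed the reduced
  degree.\<close>

lemma three_term_recurrence_orthogonal: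
  fixes L :: "real poly \<Rightarrow> real" and p :: "nat \<Rightarrow> real poly"
  assumes add: "\<And>f g. L (f + g) = L f + L g"
    and smult: "\<And>c f. L (smult c f) = c * L f"
    and rec: "\<And>n. p (Suc (Suc n)) = [:- \<alpha> n, 1:] * p (Suc n) - smult (\<beta> n) (p n)"
    and zero: "\<And>n. L (p (Suc n)) = 0"
    and "degree f < n"
  shows "L (f * p n) = 0"
  using \<open>degree f < n\<close>
proof (induction f arbitrary: n)
  case 0
  then show ?case using smult[of 0 0] by simp
next
  case (pCons c f)
  then obtain m where n: "n = Suc m" by (cases n) auto
  have "L (pCons c f * p n) = L (smult c (p n)) + L (f * pCons 0 (p n))"
    by (subst add[symmetric]) simp
  also have "L (smult c (p n)) = 0"
    using zero n by (simp add: smult)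
  also have "L (f * pCons 0 (p n)) = 0"
  \<comment> \<open>\<open>pCons c 0\<close> has degree \<open>0\<close>, so \<open>m = 0\<close> is
    possible here and \<open>degree f < m\<close> can fail.\<close>
  proof (cases "f = 0")
    case True
    then show ?thesis using smult[of 0 0] by simp
  next
    case False
    then have deg: "degree f < m" using pCons.prems n by simp
    have "pCons 0 (p n) = p (Suc n) + (smult (\<alpha> m) (p n) + smult (\<beta> m) (p m))"
      unfolding n rec by (simp add: algebra_simps)
    then have "L (f * pCons 0 (p n)) = L (f * p (Suc n)) + (\<alpha> m * L (f * p n) + \<beta> m * L (f * p m))"
      by (simp add: distrib_left add smult)
    then show ?thesis using pCons.IH deg n by simp
  qed
  finally show ?case by simp
qed

theorem theorem2:
  fixes y \<rho> q :: real and \<mu> :: "real measure"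
  assumes "prob_space \<mu>"
    and "sets \<mu> = sets borel"
    and "\<And>n :: nat. integrable \<mu> (\<lambda>x. x ^ n)"
    and "\<And>n :: nat. n \<ge> 1 \<Longrightarrow>
           (\<integral>x. poly (q_hermite q n) x \<partial>\<mu>) = \<rho> ^ n * poly (q_hermite q n) y"
  shows "\<forall>n k :: nat. k < n \<longrightarrow>
           (\<integral>x. poly (al_salam_chihara q (\<rho> * y) (\<rho>\<^sup>2) k) x
              * poly (al_salam_chihara q (\<rho> * y) (\<rho>\<^sup>2) n) x \<partial>\<mu>) = 0"
proof (intro allI impI)
  fix n k :: nat
  assume "k < n"
  interpret prob_space \<mu> by fact
  let ?p = "al_salam_chihara q (\<rho> * y) (\<rho>\<^sup>2)"
  define L :: "real poly \<Rightarrow> real" where "L = (\<lambda>f. \<integral>x. poly f x \<partial>\<mu>)"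
  have int: "integrable \<mu> (poly f)" for f :: "real poly"
    unfolding poly_altdef[abs_def] using assms(3) by auto
  \<comment> \<open>The case \<open>k = 0\<close> comes from the total mass
    \<open>1\<close>.\<close>
  have moments: "(\<integral>x. poly (q_hermite q k) x \<partial>\<mu>) = \<rho> ^ k * poly (q_hermite q k) y" for k
    using assms(4)[of k] by (cases k) (auto simp: prob_space)
  have zero: "L (?p (Suc m)) = 0" for m
  proof -
    have "L (?p (Suc m))
        = hermite_comb q (\<rho> * y) (\<rho>\<^sup>2) (Suc m) (\<lambda>k. \<integral>x. poly (q_hermite q k) x \<partial>\<mu>)"
      unfolding L_def poly_al_salam_chihara_eq_hermite_comb hermite_comb_def
      by (subst Bochner_Integration.integral_sum) (auto simp: int simp del: sum.atMost_Suc)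
    then show ?thesis unfolding moments hermite_comb_moments_eq_0 .
  qed
  have "L (?p k * ?p n) = 0"
  proof (rule three_term_recurrence_orthogonal)
    show "L (f + g) = L f + L g" for f g
      unfolding L_def poly_add by (intro Bochner_Integration.integral_add int)
    show "L (smult c f) = c * L f" for c f
      unfolding L_def poly_smult by (rule integral_mult_right_zero)
    show "degree (?p k) < n"
      using \<open>k < n\<close> al_salam_chihara_monic by simp
  qed (rule al_salam_chihara.simps(3), rule zero)
  then show "(\<integral>x. poly (?p k) x * poly (?p n) x \<partial>\<mu>) = 0"
    unfolding L_def poly_mult .
qed

end
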